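(* Let $\tilde Y=H\tilde X+\tilde C$, $H(t)=\tilde h(t)g(t)$, $g(t)=e^{t\tilde A}$, be a dual Lorentzian homothetic exponential motion in $\mathbb{D}_1^3$ with $H'(t)$ invertible, and let $\tilde P(t)=-(H'(t))^{-1}\tilde C'(t)$ and $\tilde Q(t)=H(t)\tilde P(t)+\tilde C(t)$ be its moving and fixed pole curves. Then during the motion the tangent vectors of the pole curves coincide after the rotation $g$ and the homothety $\tilde h$, that is, for all $t$, $$\tilde Q'(t)=H(t)\tilde P'(t)=\tilde h(t)\,g(t)\,\tilde P'(t).$$
   Context: Dual numbers: $\mathbb{D}=\{a+\mathcal{E}a^*: a,a^*\in\mathbb{R}\}$ with $\mathcal{E}^2=0$. $\mathbb{D}_1^3$ is the module $\mathbb{D}^3$ with the Lorentzian inner product obtained by extending $\langle a,b\rangle=a_1b_1+a_2b_2-a_3b_3$ bilinearly over $\mathbb{D}$. Let $\varepsilon=\mathrm{diag}(1,1,-1)$. A dual $3\times3$ matrix $\tilde A$ is (Lorentzian) anti-symmetric if $\tilde A=-\varepsilon\tilde A^T\varepsilon$. A dual Lorentzian homothetic exponential motion (of a moving space $K_0$ relative to a fixed space $K$) is given by $\tilde Y=H\tilde X+\tilde C$ with $H(t)=\tilde h(t)g(t)$, $g(t)=e^{t\tilde A}$, where $t$ is a real parameter, $\tilde A$ is a constant dual Lorentzian anti-symmetric $3\times3$ matrix, $\tilde h(t)$ is a non-constant invertible dual-number-valued $C^\infty$ function (identified with the scalar matrix $\tilde hI_3$), and $\tilde C(t)\in\mathbb{D}^3$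 is a $C^\infty$ column with $\tilde C'\neq0$. A prime denotes $d/dt$. The pole point at time $t$ is the point of the moving space at which the sliding velocity $H'\tilde X+\tilde C'$ vanishes; its curve in the moving space is $\tilde P(t)$, and its curve in the fixed space is $\tilde Q(t)$. *)

theory Defs
  imports "HOL-Analysis.Analysis"
begin

section \<open>Dual numbers\<close>

datatype dual = Dual (real_part: real) (dual_part: real)

lemma dual_eq_iff: "x = y \<longleftrightarrow> real_part x = real_part y \<and> dual_part x = dual_part y"
  by (cases x; cases y) simp

instantiation dual :: comm_ring_1
begin

definition "0 = Dual 0 0"
definition "1 = Dual 1 0"
definition "x + y = Dual (real_part x + real_part y) (dual_part x + dual_part y)"
definition "- x = Dual (- real_part x) (- dual_part x)"
definition "x - y = Dual (real_part x - real_part y) (dual_part x - dual_part y)"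
definition "x * y = Dual (real_part x * real_part y)
                         (real_part x * dual_part y + dual_part x * real_part y)"

instance
  by standard
    (auto simp: zero_dual_def one_dual_def plus_dual_def uminus_dual_def minus_dual_def
       times_dual_def algebra_simps dual_eq_iff)

end

instantiation dual :: real_algebra_1
begin

definition "scaleR r x = Dual (r * real_part x) (r * dual_part x)"

instance
  by standard
    (auto simp: scaleR_dual_def plus_dual_def times_dual_def dual_eq_iff algebra_simps)

end

text \<open>
  Any norm on the real plane induces the same topology and derivatives; the sum norm is chosen
  because it is submultiplicative.
\<close>

instantiation dual :: real_normed_algebra_1
begin

definition "norm x = \<bar>real_part x\<bar> + \<bar>dual_part x\<bar>"
definition sgn_dual_def: "sgn (x :: dual) = x /\<^sub>R norm x"
definition dist_dual_def: "dist x y = norm (x - y :: dual)"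
definition uniformity_dual_def [code del]:
  "(uniformity :: (dual \<times> dual) filter) = (INF e\<in>{0 <..}. principal {(x, y). dist x y < e})"
definition open_dual_def [code del]:
  "open (U :: dual set) \<longleftrightarrow> (\<forall>x\<in>U. eventually (\<lambda>(x', y). x' = x \<longrightarrow> y \<in> U) uniformity)"

instance
proof
  fix r :: real and x y :: dual and U :: "dual set"
  show "(norm x = 0) = (x = 0)" "norm (1 :: dual) = 1"
    by (auto simp: norm_dual_def zero_dual_def one_dual_def dual_eq_iff)
  show "norm (x + y) \<le> norm x + norm y"
    by (simp add: norm_dual_def plus_dual_def)
  show "norm (r *\<^sub>R x) = \<bar>r\<bar> * norm x"
    by (simp add: norm_dual_def scaleR_dual_def abs_mult algebra_simps)
  have "\<bar>real_part x * dual_part y + dual_part x * real_part y\<bar>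
      \<le> \<bar>real_part x\<bar> * \<bar>dual_part y\<bar> + \<bar>dual_part x\<bar> * \<bar>real_part y\<bar>"
    using abs_triangle_ineq[of "real_part x * dual_part y" "dual_part x * real_part y"]
    by (simp only: abs_mult)
  moreover have "0 \<le> \<bar>dual_part x\<bar> * \<bar>dual_part y\<bar>"
    by simp
  ultimately show "norm (x * y) \<le> norm x * norm y"
    unfolding norm_dual_def times_dual_def dual.sel abs_mult distrib_left distrib_right
    by linarith
qed (rule sgn_dual_def dist_dual_def open_dual_def uniformity_dual_def)+

end

lemma bounded_linear_real_part: "bounded_linear real_part"
  by (rule bounded_linear_intro[where K = 1])
    (auto simp: plus_dual_def scaleR_dual_def norm_dual_def)

lemma bounded_linear_dual_part: "bounded_linear dual_part"
  by (rule bounded_linear_intro[where K = 1])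
    (auto simp: plus_dual_def scaleR_dual_def norm_dual_def)

instance dual :: banach
proof
  fix X :: "nat \<Rightarrow> dual"
  assume X: "Cauchy X"
  obtain a where a: "(\<lambda>n. real_part (X n)) \<longlonglongrightarrow> a"
    using bounded_linear.Cauchy[OF bounded_linear_real_part X] Cauchy_convergent_iff convergent_def
    by blast
  obtain b where b: "(\<lambda>n. dual_part (X n)) \<longlonglongrightarrow> b"
    using bounded_linear.Cauchy[OF bounded_linear_dual_part X] Cauchy_convergent_iff convergent_def
    by blast
  have "(\<lambda>n. \<bar>real_part (X n) - a\<bar> + \<bar>dual_part (X n) - b\<bar>) \<longlonglongrightarrow> 0"
    using tendsto_add[OF tendsto_rabs[OF LIM_zero[OF a]] tendsto_rabs[OF LIM_zero[OF b]]] by simp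
  then have "X \<longlonglongrightarrow> Dual a b"
    by (simp add: tendsto_dist_iff[of X] dist_dual_def norm_dual_def minus_dual_def)
  then show "convergent X"
    by (auto simp: convergent_def)
qed

definition dual_unit :: dual
  where "dual_unit = Dual 0 1"

lemma dual_unit_square: "dual_unit * dual_unit = 0"
  by (simp add: dual_unit_def times_dual_def zero_dual_def)

lemma Dual_eq: "Dual a b = of_real a + dual_unit * of_real b"
  by (simp add: of_real_def dual_unit_def times_dual_def plus_dual_def scaleR_dual_def one_dual_def)


section \<open>Lorentzian anti-symmetric dual matrices\<close>

definition lorentz_inner :: "dual^3 \<Rightarrow> dual^3 \<Rightarrow> dual"
  where "lorentz_inner x y = x $ 1 * y $ 1 + x $ 2 * y $ 2 - x $ 3 * y $ 3"

definition lorentz_sign :: "dual^3^3"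
  where "lorentz_sign = (\<chi> i j. if i = j then (if i = 3 then - 1 else 1) else 0)"

definition lorentz_antisymmetric :: "dual^3^3 \<Rightarrow> bool"
  where "lorentz_antisymmetric A \<longleftrightarrow> A = - (lorentz_sign ** transpose A ** lorentz_sign)"

lemma lorentz_antisymmetric_iff:
  "lorentz_antisymmetric A \<longleftrightarrow>
     (\<forall>x y. lorentz_inner (A *v x) y = - lorentz_inner x (A *v y))"
proof -
  have z: "d = - d \<longleftrightarrow> d = 0" "- d = d \<longleftrightarrow> d = 0" for d :: dual
    by (auto simp: dual_eq_iff zero_dual_def uminus_dual_def)
  have entries: "lorentz_antisymmetric A \<longleftrightarrow>
      A $ 1 $ 1 = 0 \<and> A $ 2 $ 2 = 0 \<and> A $ 3 $ 3 = 0 \<and>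
      A $ 2 $ 1 = - A $ 1 $ 2 \<and> A $ 3 $ 1 = A $ 1 $ 3 \<and> A $ 3 $ 2 = A $ 2 $ 3"
    unfolding lorentz_antisymmetric_def
    by (auto simp: vec_eq_iff forall_3 matrix_matrix_mult_def transpose_def lorentz_sign_def
        sum_3 z)
  show ?thesis
  proof
    assume "lorentz_antisymmetric A"
    then show "\<forall>x y. lorentz_inner (A *v x) y = - lorentz_inner x (A *v y)"
      by (simp add: entries lorentz_inner_def matrix_vector_mult_def sum_3 algebra_simps)
  next
    assume "\<forall>x y. lorentz_inner (A *v x) y = - lorentz_inner x (A *v y)"
    then have *: "lorentz_inner (A *v axis i 1) (axis j 1)
        = - lorentz_inner (axis i 1) (A *v axis j 1)" for i j
      by blast
    show "lorentz_antisymmetric A"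
      using *[of 1 1] *[of 2 2] *[of 3 3] *[of 1 2] *[of 1 3] *[of 2 3]
      by (simp add: entries lorentz_inner_def matrix_vector_mult_def sum_3 axis_def z)
  qed
qed


section \<open>Exponential of a dual matrix\<close>

text \<open>
  The powers are those of the matrix product; the overloaded power on the vector type is
  componentwise.
\<close>

definition dual_matrix_exp :: "dual^3^3 \<Rightarrow> dual^3^3"
  where "dual_matrix_exp A = (\<Sum>n. (((**) A ^^ n) (mat 1)) /\<^sub>R fact n)"

lemma summable_dual_matrix_exp:
  fixes A :: "dual^3^3"
  shows "summable (\<lambda>n. (((**) A ^^ n) (mat 1)) /\<^sub>R fact n)"
proof -
  let ?K = "27 * norm A"
  have entry: "norm (B $ i $ j) \<le> norm B" for B :: "dual^3^3" and i j
    by (meson Finite_Cartesian_Product.norm_nth_le order_trans)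
  have mult: "norm (A ** B) \<le> ?K * norm B" for B :: "dual^3^3"
  proof -
    have e: "norm ((A ** B) $ i $ j) \<le> 3 * (norm A * norm B)" for i j
    proof -
      have "norm ((A ** B) $ i $ j) \<le> (\<Sum>k\<in>UNIV. norm (A $ i $ k * B $ k $ j))"
        by (simp add: matrix_matrix_mult_def norm_sum)
      also have "\<dots> \<le> (\<Sum>k\<in>(UNIV :: 3 set). norm A * norm B)"
        by (intro sum_mono order_trans[OF norm_mult_ineq] mult_mono entry) auto
      finally show ?thesis by simp
    qed
    have r: "norm ((A ** B) $ i) \<le> 9 * (norm A * norm B)" for i
    proof -
      have "norm ((A ** B) $ i) \<le> (\<Sum>j\<in>UNIV. norm ((A ** B) $ i $ j))"
        unfolding norm_vec_def[of "(A ** B) $ i"] by (rule L2_set_le_sum) simp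
      also have "\<dots> \<le> (\<Sum>j\<in>(UNIV :: 3 set). 3 * (norm A * norm B))"
        by (intro sum_mono e)
      finally show ?thesis by simp
    qed
    have "norm (A ** B) \<le> (\<Sum>i\<in>UNIV. norm ((A ** B) $ i))"
      unfolding norm_vec_def[of "A ** B"] by (rule L2_set_le_sum) simp
    also have "\<dots> \<le> (\<Sum>i\<in>(UNIV :: 3 set). 9 * (norm A * norm B))"
      by (intro sum_mono r)
    finally show ?thesis by simp
  qed
  have pow: "norm (((**) A ^^ n) (mat 1)) \<le> ?K ^ n * norm (mat 1 :: dual^3^3)" for n
  proof (induction n)
    case (Suc n)
    have "norm (((**) A ^^ Suc n) (mat 1)) \<le> ?K * norm (((**) A ^^ n) (mat 1))"
      using mult by simp
    also have "\<dots> \<le> ?K * (?K ^ n * norm (mat 1 :: dual^3^3))"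
      by (intro mult_left_mono Suc.IH) simp
    finally show ?case by (simp add: mult.assoc)
  qed simp
  have "summable (\<lambda>n. (?K ^ n /\<^sub>R fact n) * norm (mat 1 :: dual^3^3))"
    by (intro summable_mult2 summable_exp_generic)
  then show ?thesis
  proof (rule summable_comparison_test'[where N = 0])
    fix n :: nat
    show "norm ((((**) A ^^ n) (mat 1)) /\<^sub>R fact n)
        \<le> (?K ^ n /\<^sub>R fact n) * norm (mat 1 :: dual^3^3)"
      using mult_left_mono[OF pow[of n], of "inverse (fact n)"] by (simp add: mult.assoc)
  qed
qed


section \<open>Smooth functions of a real parameter\<close>

definition deriv_curve :: "(real \<Rightarrow> 'a::real_normed_vector) \<Rightarrow> real \<Rightarrow> 'a"
  where "deriv_curve f t = vector_derivative f (at t)"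

definition smooth_curve :: "(real \<Rightarrow> 'a::real_normed_vector) \<Rightarrow> bool"
  where "smooth_curve f \<longleftrightarrow> (\<forall>n t. ((deriv_curve ^^ n) f) differentiable (at t))"

end

theory Submission
  imports Defs
begin

text \<open>
  Differentiating \<open>Q = H P + C\<close> gives \<open>Q' = H' P + H P' + C'\<close>, and \<open>H' P = - C'\<close> by the choice
  of \<open>P\<close>. The work lies in the differentiability of \<open>P\<close>: the exponential is differentiated
  entrywise as a real power series, so \<open>H'\<close> is itself differentiable, and the resolvent identity
  \<open>N s - N t = - N s (M s - M t) N t\<close> for \<open>N = M\<^sup>-\<^sup>1\<close> first shows that the inverse is continuous
  and then that it is differentiable.
\<close>

section \<open>Matrix products as bounded bilinear maps\<close>

lemma norm_vec_le_sum: "norm x \<le> (\<Sum>i\<in>UNIV. norm (x $ i))"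
  unfolding norm_vec_def by (rule L2_set_le_sum) simp

lemma norm_matrix_entry_le: "norm (A $ i $ j) \<le> norm A"
  by (meson Finite_Cartesian_Product.norm_nth_le order_trans)

text \<open>Boundedness is what makes the product rule available for curves of matrices and vectors.
  The entries need not commute.\<close>

lemma bounded_bilinear_matrix_vector_mult:
  "bounded_bilinear ((*v) :: 'a::real_normed_algebra_1^'n^'m \<Rightarrow> 'a^'n \<Rightarrow> 'a^'m)"
proof
  fix A B :: "'a^'n^'m" and x y :: "'a^'n" and r :: real
  show "(A + B) *v x = A *v x + B *v x"
    by (simp add: matrix_vector_mult_def vec_eq_iff sum.distrib distrib_right)
  show "A *v (x + y) = A *v x + A *v y"
    by (simp add: matrix_vector_mult_def vec_eq_iff sum.distrib distrib_left)
  show "(r *\<^sub>R A) *v x = r *\<^sub>R (A *v x)" "A *v (r *\<^sub>R x) = r *\<^sub>R (A *v x)"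
    by (simp_all add: matrix_vector_mult_def vec_eq_iff scaleR_sum_right)
  \<comment> \<open>Each product of entries is at most \<open>norm A * norm x\<close>; the constant
    is the number of such products, written as a sum of ones.\<close>
  have "norm (A *v x) \<le> norm A * norm x * (\<Sum>i\<in>(UNIV :: 'm set). \<Sum>j\<in>(UNIV :: 'n set). 1)"
    for A :: "'a^'n^'m" and x
  proof -
    have "norm (A *v x) \<le> (\<Sum>i\<in>UNIV. norm (\<Sum>j\<in>UNIV. A $ i $ j * x $ j))"
      using norm_vec_le_sum[of "A *v x"] by (simp add: matrix_vector_mult_def)
    also have "\<dots> \<le> (\<Sum>i\<in>(UNIV :: 'm set). \<Sum>j\<in>(UNIV :: 'n set). norm A * norm x)"
      by (intro sum_mono order_trans[OF norm_sum] order_trans[OF norm_mult_ineq] mult_mono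
          norm_matrix_entry_le Finite_Cartesian_Product.norm_nth_le) auto
    finally show ?thesis by (simp add: ac_simps)
  qed
  then show "\<exists>K. \<forall>(A :: 'a^'n^'m) x. norm (A *v x) \<le> norm A * norm x * K"
    by blast
qed

lemma bounded_bilinear_matrix_matrix_mult:
  "bounded_bilinear ((**) :: 'a::real_normed_algebra_1^'n^'m \<Rightarrow> 'a^'p^'n \<Rightarrow> 'a^'p^'m)"
proof
  fix A B :: "'a^'n^'m" and X Y :: "'a^'p^'n" and r :: real
  show "(A + B) ** X = A ** X + B ** X"
    by (simp add: matrix_matrix_mult_def vec_eq_iff sum.distrib distrib_right)
  show "A ** (X + Y) = A ** X + A ** Y"
    by (rule matrix_add_ldistrib)
  show "(r *\<^sub>R A) ** X = r *\<^sub>R (A ** X)" "A ** (r *\<^sub>R X) = r *\<^sub>R (A ** X)"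
    by (simp_all add: matrix_matrix_mult_def vec_eq_iff scaleR_sum_right)
  have "norm (A ** X)
      \<le> norm A * norm X * (\<Sum>i\<in>(UNIV :: 'm set). \<Sum>k\<in>(UNIV :: 'p set). \<Sum>j\<in>(UNIV :: 'n set). 1)"
    for A :: "'a^'n^'m" and X :: "'a^'p^'n"
  proof -
    have "norm (A ** X) \<le> (\<Sum>i\<in>UNIV. norm ((A ** X) $ i))"
      by (rule norm_vec_le_sum)
    also have "\<dots> \<le> (\<Sum>i\<in>UNIV. \<Sum>k\<in>UNIV. norm (\<Sum>j\<in>UNIV. A $ i $ j * X $ j $ k))"
      by (intro sum_mono order_trans[OF norm_vec_le_sum]) (simp add: matrix_matrix_mult_def)
    also have "\<dots> \<le> (\<Sum>i\<in>(UNIV :: 'm set). \<Sum>k\<in>(UNIV :: 'p set). \<Sum>j\<in>(UNIV :: 'n set).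
        norm A * norm X)"
      by (intro sum_mono order_trans[OF norm_sum] order_trans[OF norm_mult_ineq] mult_mono
          norm_matrix_entry_le) auto
    finally show ?thesis by (simp add: ac_simps)
  qed
  then show "\<exists>K. \<forall>(A :: 'a^'n^'m) (X :: 'a^'p^'n). norm (A ** X) \<le> norm A * norm X * K"
    by blast
qed

text \<open>Carries derivatives of the scalar \<open>h\<close> over to the scalar matrix
  \<open>mat (h t)\<close>.\<close>

lemma bounded_linear_mat:
  "bounded_linear (mat :: 'a::real_normed_algebra_1 \<Rightarrow> 'a^'n^'n)"
proof (rule bounded_linear_intro)
  fix x y :: 'a and r :: real
  show "mat (x + y) = (mat x + mat y :: 'a^'n^'n)" "mat (r *\<^sub>R x) = (r *\<^sub>R mat x :: 'a^'n^'n)"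
    by (simp_all add: mat_def vec_eq_iff)
  have "norm (mat x :: 'a^'n^'n) \<le> (\<Sum>i\<in>UNIV. norm ((mat x :: 'a^'n^'n) $ i))"
    by (rule norm_vec_le_sum)
  also have "\<dots> \<le> (\<Sum>i\<in>(UNIV :: 'n set). \<Sum>j\<in>(UNIV :: 'n set). norm x)"
    by (intro sum_mono order_trans[OF norm_vec_le_sum]) (simp add: mat_def)
  finally show "norm (mat x :: 'a^'n^'n) \<le> norm x * (\<Sum>i\<in>(UNIV :: 'n set). \<Sum>j\<in>(UNIV :: 'n set). 1)"
    by (simp add: ac_simps)
qed

lemma mat_matrix_vector_mult: "mat c *v x = c *s x"
  by (simp add: mat_def matrix_vector_mult_def vec_eq_iff if_distrib[of "\<lambda>y. y * _"] cong: if_cong)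

lemma matrix_inv_inverse:
  assumes "invertible A"
  shows "A ** matrix_inv A = mat 1" "matrix_inv A ** A = mat 1"
proof -
  have "A ** matrix_inv A = mat 1 \<and> matrix_inv A ** A = mat 1"
    using assms unfolding invertible_def matrix_inv_def by (rule someI_ex)
  then show "A ** matrix_inv A = mat 1" "matrix_inv A ** A = mat 1"
    by blast+
qed


section \<open>Derivative of the inverse matrix\<close>

text \<open>In quotient form, the resolvent identity can be substituted and the limit taken factor
  by factor.\<close>

lemma has_vector_derivative_iff_quotient:
  "(f has_vector_derivative D) (at t) \<longleftrightarrow> ((\<lambda>s. (f s - f t) /\<^sub>R (s - t)) \<longlongrightarrow> D) (at t)"
proof -
  have eq: "norm (f s - f t - (s - t) *\<^sub>R D) / norm (s - t) = norm ((f s - f t) /\<^sub>R (s - t) - D)"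
    if "s \<noteq> t" for s
  proof -
    have "(f s - f t) /\<^sub>R (s - t) - D = (f s - f t - (s - t) *\<^sub>R D) /\<^sub>R (s - t)"
      using that by (simp add: scaleR_diff_right)
    then show ?thesis by (simp add: divide_inverse mult.commute)
  qed
  have "(f has_vector_derivative D) (at t)
      \<longleftrightarrow> ((\<lambda>s. norm (f s - f t - (s - t) *\<^sub>R D) / norm (s - t)) \<longlongrightarrow> 0) (at t)"
    by (simp add: has_vector_derivative_def has_derivative_iff_norm bounded_linear_scaleR_left)
  also have "\<dots> \<longleftrightarrow> ((\<lambda>s. norm ((f s - f t) /\<^sub>R (s - t) - D)) \<longlongrightarrow> 0) (at t)"
    \<comment> \<open>At \<open>s = t\<close> the two expressions are 0 and \<open>norm D\<close>,
      but the filter \<open>at t\<close> ignores that point.\<close>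
    by (rule tendsto_cong) (use eq in \<open>auto simp: eventually_at_filter\<close>)
  also have "\<dots> \<longleftrightarrow> ((\<lambda>s. (f s - f t) /\<^sub>R (s - t)) \<longlongrightarrow> D) (at t)"
    by (simp only: tendsto_norm_zero_iff LIM_zero_iff)
  finally show ?thesis .
qed

text \<open>No regularity of \<open>N\<close> is assumed, and no determinant occurs, so zero
  divisors among the entries do no harm.\<close>

lemma has_vector_derivative_matrix_inverse:
  fixes M N :: "real \<Rightarrow> 'a::real_normed_algebra_1^'n^'n"
  assumes M: "(M has_vector_derivative D) (at t)"
    and MN: "\<And>s. M s ** N s = mat 1"
    and NM: "\<And>s. N s ** M s = mat 1"
  shows "(N has_vector_derivative - (N t ** (D ** N t))) (at t)"
proof -
  interpret mm: bounded_bilinear "(**) :: 'a^'n^'n \<Rightarrow> 'a^'n^'n \<Rightarrow> 'a^'n^'n"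
    by (rule bounded_bilinear_matrix_matrix_mult)
  have resolvent: "N s - N t = - (N s ** ((M s - M t) ** N t))" for s
  proof -
    have "N s ** (M s ** N t) = N t"
      by (simp add: matrix_mul_assoc NM)
    then show ?thesis
      by (simp add: mm.diff_left mm.diff_right MN)
  qed
  obtain K where K: "K > 0" "\<And>X Y. norm ((X :: 'a^'n^'n) ** (Y :: 'a^'n^'n)) \<le> norm X * norm Y * K"
    using mm.pos_bounded by blast
  \<comment> \<open>One factor \<open>K\<close> for each of the two products in the resolvent
    identity. The resulting bound on \<open>N s - N t\<close> still contains the uncontrolled
    \<open>norm (N s)\<close>.\<close>
  define e where "e s = norm (M s - M t) * norm (N t) * K * K" for s
  have "(M \<longlongrightarrow> M t) (at t)"
    using has_vector_derivative_continuous[OF M] by (simp add: isCont_def)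
  then have e0: "(e \<longlongrightarrow> 0) (at t)"
    unfolding e_def by (intro tendsto_mult_left_zero tendsto_norm_zero LIM_zero)
  have diff: "norm (N s - N t) \<le> norm (N s) * e s" for s
  proof -
    have "norm (N s - N t) \<le> norm (N s) * norm ((M s - M t) ** N t) * K"
      unfolding resolvent norm_minus_cancel by (rule K)
    also have "\<dots> \<le> norm (N s) * (norm (M s - M t) * norm (N t) * K) * K"
      by (intro mult_right_mono mult_left_mono K(2)) (use K(1) in auto)
    finally show ?thesis by (simp add: e_def mult.assoc)
  qed
  \<comment> \<open>Below 1/2 the unknown can be absorbed: \<open>norm (N s)\<close> is at most
    \<open>norm (N t)\<close> plus half of itself, hence at most
    \<open>2 * norm (N t)\<close>.\<close>
  have "eventually (\<lambda>s. e s < 1 / 2) (at t)"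
    using e0 by (rule order_tendstoD) simp
  then have "eventually (\<lambda>s. norm (N s - N t) \<le> 2 * norm (N t) * e s) (at t)"
  proof eventually_elim
    case (elim s)
    have e: "e s \<ge> 0"
      using K(1) by (simp add: e_def)
    have "norm (N s) \<le> norm (N t) + norm (N s - N t)"
      by (metis add.commute diff_add_cancel norm_triangle_ineq)
    also have "norm (N s - N t) \<le> norm (N s) * (1 / 2)"
      using diff[of s] mult_left_mono[of "e s" "1 / 2" "norm (N s)"] elim by simp
    finally have "norm (N s) \<le> 2 * norm (N t)"
      by simp
    then show ?case
      using diff[of s] mult_right_mono[OF _ e, of "norm (N s)" "2 * norm (N t)"] by linarith
  qed
  moreover have "((\<lambda>s. 2 * norm (N t) * e s) \<longlongrightarrow> 0) (at t)"
    by (intro tendsto_mult_right_zero e0)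
  ultimately have "((\<lambda>s. N s - N t) \<longlongrightarrow> 0) (at t)"
    by (rule Lim_null_comparison)
  then have N: "(N \<longlongrightarrow> N t) (at t)"
    by (simp only: LIM_zero_iff)
  \<comment> \<open>By the resolvent identity this is the difference quotient of \<open>N\<close>;
    all its factors now have known limits.\<close>
  have "((\<lambda>s. - (N s ** (((M s - M t) /\<^sub>R (s - t)) ** N t))) \<longlongrightarrow> - (N t ** (D ** N t))) (at t)"
    using M unfolding has_vector_derivative_iff_quotient
    by (intro tendsto_minus mm.tendsto N tendsto_const)
  then show ?thesis
    unfolding has_vector_derivative_iff_quotient resolvent
    by (simp add: mm.scaleR_left mm.scaleR_right)
qed


section \<open>Derivative of the exponential\<close>

text \<open>A real functional turns the vector series into a real power series converging
  everywhere, which may be differentiated termwise.\<close>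

lemma bounded_linear_has_vector_derivative_powser:
  fixes x :: "nat \<Rightarrow> 'a::real_normed_vector"
  assumes L: "bounded_linear L"
    and x: "\<And>t. summable (\<lambda>n. (t ^ n / fact n) *\<^sub>R x n)"
    and y: "(\<lambda>n. (t ^ n / fact n) *\<^sub>R x (Suc n)) sums y"
  shows "((\<lambda>t. L (\<Sum>n. (t ^ n / fact n) *\<^sub>R x n)) has_vector_derivative (L y :: real)) (at t)"
proof -
  interpret bounded_linear L by (rule L)
  define c where "c n = L (x n) / fact n" for n
  have c: "L ((t ^ n / fact n) *\<^sub>R x n) = c n * t ^ n" for t n
    by (simp add: c_def scaleR)
  have L_sums: "(\<lambda>n. c n * t ^ n) sums L (\<Sum>n. (t ^ n / fact n) *\<^sub>R x n)" for t
    using sums[OF summable_sums[OF x[of t]]] by (simp only: c)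
  \<comment> \<open>The factor n+1 from differentiation cancels against the factorial of n+1,
    leaving only a shift of \<open>x\<close>.\<close>
  have "diffs c n * t ^ n = L ((t ^ n / fact n) *\<^sub>R x (Suc n))" for n
    by (simp add: diffs_def c_def scaleR del: of_nat_Suc)
  then have "(\<Sum>n. diffs c n * t ^ n) = L y"
    using sums_unique[OF sums[OF y]] by simp
  moreover have "((\<lambda>t. \<Sum>n. c n * t ^ n) has_real_derivative (\<Sum>n. diffs c n * t ^ n)) (at t)"
    by (rule termdiffs_strong_converges_everywhere) (use L_sums in \<open>blast intro: sums_summable\<close>)
  ultimately show ?thesis
    using sums_unique[OF L_sums] by (simp add: has_real_derivative_iff_has_vector_derivative)
qed

lemma has_vector_derivative_dualI:
  assumes "((\<lambda>t. real_part (f t)) has_vector_derivative real_part D) F"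
    and "((\<lambda>t. dual_part (f t)) has_vector_derivative dual_part D) F"
  shows "(f has_vector_derivative D) F"
proof -
  have d: "x = real_part x *\<^sub>R 1 + dual_part x *\<^sub>R dual_unit" for x
    by (simp add: dual_eq_iff plus_dual_def scaleR_dual_def one_dual_def dual_unit_def)
  have "((\<lambda>t. real_part (f t) *\<^sub>R 1 + dual_part (f t) *\<^sub>R dual_unit) has_vector_derivative
      real_part D *\<^sub>R 1 + dual_part D *\<^sub>R dual_unit) F"
    by (intro has_vector_derivative_add assms
        bounded_linear.has_vector_derivative[OF bounded_linear_scaleR_left])
  then show ?thesis
    by (simp only: d[symmetric])
qed

text \<open>A vector is the sum of its coordinates embedded by the bounded linear maps
  \<open>axis i\<close>, so coordinatewise derivatives can be summed.\<close>

lemma has_vector_derivative_vecI: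
  fixes f :: "real \<Rightarrow> 'a::real_normed_vector^'n"
  assumes "\<And>i. ((\<lambda>t. f t $ i) has_vector_derivative D $ i) F"
  shows "(f has_vector_derivative D) F"
proof -
  have axis: "bounded_linear (axis i :: 'a \<Rightarrow> 'a^'n)" for i
  proof (rule bounded_linear_intro)
    show "norm (axis i x :: 'a^'n) \<le> norm x * 1" for x
      using norm_vec_le_sum[of "axis i x"]
      by (simp add: axis_def if_distrib[of norm] cong: if_cong)
  qed (simp_all add: axis_def vec_eq_iff)
  have x: "(\<Sum>i\<in>UNIV. axis i (x $ i)) = x" for x :: "'a^'n"
    by (simp add: vec_eq_iff axis_def if_distrib cong: if_cong)
  have "((\<lambda>t. \<Sum>i\<in>UNIV. axis i (f t $ i)) has_vector_derivative (\<Sum>i\<in>UNIV. axis i (D $ i))) F"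
    by (intro has_vector_derivative_sum bounded_linear.has_vector_derivative[OF axis] assms)
  then show ?thesis
    by (simp only: x)
qed

lemma has_vector_derivative_dual_matrix_exp:
  "((\<lambda>t. dual_matrix_exp (t *\<^sub>R A)) has_vector_derivative A ** dual_matrix_exp (t *\<^sub>R A)) (at t)"
proof -
  interpret mm: bounded_bilinear "(**) :: dual^3^3 \<Rightarrow> dual^3^3 \<Rightarrow> dual^3^3"
    by (rule bounded_bilinear_matrix_matrix_mult)
  define x where "x n = ((**) A ^^ n) (mat 1)" for n
  have "((**) (t *\<^sub>R A) ^^ n) (mat 1) = t ^ n *\<^sub>R x n" for t n
    by (induction n) (simp_all add: x_def mm.scaleR_left mm.scaleR_right)
  then have exp_term: "((**) (t *\<^sub>R A) ^^ n) (mat 1) /\<^sub>R fact n = (t ^ n / fact n) *\<^sub>R x n" for t n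
    by (simp add: divide_inverse mult.commute)
  have sm: "summable (\<lambda>n. (t ^ n / fact n) *\<^sub>R x n)" for t
    using summable_dual_matrix_exp[of "t *\<^sub>R A"] by (simp only: exp_term)
  have exp: "dual_matrix_exp (t *\<^sub>R A) = (\<Sum>n. (t ^ n / fact n) *\<^sub>R x n)" for t
    unfolding dual_matrix_exp_def exp_term ..
  have "(\<lambda>n. A ** ((t ^ n / fact n) *\<^sub>R x n)) sums (A ** dual_matrix_exp (t *\<^sub>R A))"
    unfolding exp by (intro bounded_linear.sums[OF mm.bounded_linear_right] summable_sums sm)
  then have y: "(\<lambda>n. (t ^ n / fact n) *\<^sub>R x (Suc n)) sums (A ** dual_matrix_exp (t *\<^sub>R A))"
    by (simp add: mm.scaleR_right x_def)
  have entry: "bounded_linear (\<lambda>X :: dual^3^3. X $ i $ j)" for i j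
    by (rule bounded_linear_compose[OF bounded_linear_vec_nth bounded_linear_vec_nth])
  note D = bounded_linear_has_vector_derivative_powser[OF _ sm y, folded exp]
  show ?thesis
    \<comment> \<open>The functionals are the real and dual parts of the nine entries; together they
      determine the matrix.\<close>
    by (intro has_vector_derivative_vecI has_vector_derivative_dualI
        D[OF bounded_linear_compose[OF bounded_linear_real_part entry]]
        D[OF bounded_linear_compose[OF bounded_linear_dual_part entry]])
qed


section \<open>Pole curves\<close>

lemma has_vector_derivative_deriv_curve:
  "f differentiable (at t) \<Longrightarrow> (f has_vector_derivative deriv_curve f t) (at t)"
  by (simp add: deriv_curve_def vector_derivative_works)

lemma smooth_curve_differentiable:
  assumes "smooth_curve f"
  shows "f differentiable (at t)" "deriv_curve f differentiable (at t)"
  using assms[unfolded smooth_curve_def, rule_format, of 0 t]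
    assms[unfolded smooth_curve_def, rule_format, of 1 t] by simp_all

lemma deriv_curve_eq: "(f has_vector_derivative D) (at t) \<Longrightarrow> deriv_curve f t = D"
  by (simp add: deriv_curve_def vector_derivative_at)

text \<open>The exponential reproduces itself under differentiation up to the factor
  \<open>A\<close>, so two derivatives of \<open>h\<close> give two of \<open>H\<close>.\<close>

lemma deriv_curve_homothetic_exp_differentiable:
  assumes h: "smooth_curve h"
    and H: "\<And>t. H t = mat (h t) ** dual_matrix_exp (t *\<^sub>R A)"
  shows "H differentiable (at t)" "deriv_curve H differentiable (at t)"
proof -
  note mult = bounded_bilinear.has_vector_derivative[OF bounded_bilinear_matrix_matrix_mult]
  note mat = bounded_linear.has_vector_derivative[OF bounded_linear_mat
      has_vector_derivative_deriv_curve[OF smooth_curve_differentiable(1)[OF h]]]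
    bounded_linear.has_vector_derivative[OF bounded_linear_mat
      has_vector_derivative_deriv_curve[OF smooth_curve_differentiable(2)[OF h]]]
  let ?E = "\<lambda>t. dual_matrix_exp (t *\<^sub>R A)"
  have H': "(H has_vector_derivative mat (h t) ** (A ** ?E t) + mat (deriv_curve h t) ** ?E t) (at t)"
    for t
    using mult[OF mat(1) has_vector_derivative_dual_matrix_exp] unfolding H .
  then show "H differentiable (at t)"
    by (rule differentiableI_vector)
  have eq: "deriv_curve H = (\<lambda>t. mat (h t) ** (A ** ?E t) + mat (deriv_curve h t) ** ?E t)"
    using deriv_curve_eq[OF H'] by blast
  show "deriv_curve H differentiable (at t)"
    unfolding eq
    \<comment> \<open>Only existence matters here: the second derivative stays schematic and is
      assembled by the rules.\<close>
    by (rule differentiableI_vector has_vector_derivative_add mult mat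
        has_vector_derivative_dual_matrix_exp has_vector_derivative_const)+
qed

text \<open>Differentiability belongs to the conclusion because \<open>vector_derivative\<close> is
  a choice operator that yields some value even where no derivative exists.\<close>

theorem corollary2:
  fixes h :: "real \<Rightarrow> dual"
    and A :: "dual^3^3"
    and C :: "real \<Rightarrow> dual^3"
    and g H :: "real \<Rightarrow> dual^3^3"
    and P Q :: "real \<Rightarrow> dual^3"
  assumes "lorentz_antisymmetric A"
    and "smooth_curve h"
    and "\<And>t. h t dvd 1"
    and "\<not> (\<exists>c. \<forall>t. h t = c)"
    and "smooth_curve C"
    and "\<not> (\<forall>t. deriv_curve C t = 0)"
    and "\<And>t. g t = dual_matrix_exp (t *\<^sub>R A)"
    and "\<And>t. H t = mat (h t) ** g t"
    and "\<And>t. invertible (deriv_curve H t)"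
    and "\<And>t. P t = - (matrix_inv (deriv_curve H t) *v deriv_curve C t)"
    and "\<And>t. Q t = H t *v P t + C t"
  shows "\<forall>t. P differentiable (at t) \<and> Q differentiable (at t) \<and>
           deriv_curve Q t = H t *v deriv_curve P t \<and>
           H t *v deriv_curve P t = h t *s (g t *v deriv_curve P t)"
proof
  fix t
  interpret mv: bounded_bilinear "(*v) :: dual^3^3 \<Rightarrow> dual^3 \<Rightarrow> dual^3"
    by (rule bounded_bilinear_matrix_vector_mult)
  have H: "H t = mat (h t) ** dual_matrix_exp (t *\<^sub>R A)" for t
    by (simp only: assms)
  note dH = deriv_curve_homothetic_exp_differentiable[OF \<open>smooth_curve h\<close> H]
  note dC = smooth_curve_differentiable[OF \<open>smooth_curve C\<close>]
  note inv = matrix_inv_inverse[OF \<open>\<And>t. invertible (deriv_curve H t)\<close>]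
  \<comment> \<open>The inverse rule is applied to the curve \<open>deriv_curve H\<close>. The
    explicit value serves only to show that \<open>P\<close> is differentiable.\<close>
  have "((\<lambda>t. - (matrix_inv (deriv_curve H t) *v deriv_curve C t)) has_vector_derivative
      - (matrix_inv (deriv_curve H t) *v deriv_curve (deriv_curve C) t
        + - (matrix_inv (deriv_curve H t) ** (deriv_curve (deriv_curve H) t
          ** matrix_inv (deriv_curve H t))) *v deriv_curve C t)) (at t)"
    by (intro has_vector_derivative_minus mv.has_vector_derivative
        has_vector_derivative_matrix_inverse[where M = "deriv_curve H"]
        has_vector_derivative_deriv_curve dH dC inv)
  then have P: "P differentiable (at t)"
    unfolding assms(10)[symmetric] by (rule differentiableI_vector)
  have "(Q has_vector_derivative
      H t *v deriv_curve P t + deriv_curve H t *v P t + deriv_curve C t) (at t)"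
    unfolding assms(11)
    by (intro has_vector_derivative_add mv.has_vector_derivative
        has_vector_derivative_deriv_curve dH dC P)
  \<comment> \<open>The sliding velocity vanishes at the pole, which removes the last two terms of
    the derivative of \<open>Q\<close>.\<close>
  moreover have "deriv_curve H t *v P t = - deriv_curve C t"
    by (simp add: assms(10) mv.minus_right matrix_vector_mul_assoc inv)
  ultimately have Q: "(Q has_vector_derivative H t *v deriv_curve P t) (at t)"
    by simp
  have "H t *v deriv_curve P t = h t *s (g t *v deriv_curve P t)"
    by (simp only: assms(8) matrix_vector_mul_assoc[symmetric] mat_matrix_vector_mult)
  then show "P differentiable (at t) \<and> Q differentiable (at t) \<and>
      deriv_curve Q t = H t *v deriv_curve P t \<and>
      H t *v deriv_curve P t = h t *s (g t *v deriv_curve P t)"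
    using P deriv_curve_eq[OF Q] differentiableI_vector[OF Q] by blast
qed

end
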